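(* Let $x,y\geqslant 3$ be real numbers and let $\lambda$ be a real number with $$ 3 \leqslant \lambda\leqslant \frac{\log y}{(\log \log y)^2}, $$ and suppose that $$ \exp\left(20\lambda \,\log(\lambda\log \log x)\, \log \log x\right)\leqslant y\leqslant x. $$ Then, for all but at most $O(x^{0.49})$ natural numbers $q \leqslant x$, we have $$ \max_{\chi \in \mathcal{X}_q^*} \left|\sum_{1 \leqslant a \leqslant y} \chi(a)\right|\ll \frac{y}{(\log y)^{\lambda\log 2-1}}, $$ where the implied constants (both in $O(x^{0.49})$ and in $\ll$) are absolute; in particular they do not depend on $\lambda$.
   Context: $\mathcal{X}_q^*$ denotes the set of all primitive Dirichlet characters modulo $q$; the sum runs over integers $a$ with $1\leqslant a\leqslant y$. $U\ll V$ and $U=O(V)$ mean $|U|\leqslant cV$ for an absolute constant $c>0$. *)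

theory Defs
  imports "HOL-Analysis.Analysis" "HOL-Number_Theory.Cong"
begin

definition dirichlet_character :: "nat \<Rightarrow> (nat \<Rightarrow> complex) \<Rightarrow> bool" where
  "dirichlet_character q chi \<longleftrightarrow>
     q \<ge> 1 \<and> chi 1 = 1 \<and>
     (\<forall>m n. chi (m * n) = chi m * chi n) \<and>
     (\<forall>n. chi (n + q) = chi n) \<and>
     (\<forall>n. chi n = 0 \<longleftrightarrow> \<not> coprime n q)"

definition induced_modulus :: "nat \<Rightarrow> (nat \<Rightarrow> complex) \<Rightarrow> nat \<Rightarrow> bool" where
  "induced_modulus q chi d \<longleftrightarrow>
     (\<forall>n. coprime n q \<and> [n = 1] (mod d) \<longrightarrow> chi n = 1)"

definition primitive_character :: "nat \<Rightarrow> (nat \<Rightarrow> complex) \<Rightarrow> bool" where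
  "primitive_character q chi \<longleftrightarrow>
     dirichlet_character q chi \<and> (\<forall>d. d dvd q \<and> d < q \<longrightarrow> \<not> induced_modulus q chi d)"

end

theory Submission
  imports Defs "HOL-Number_Theory.Residues"
begin

text \<open>
  By the mean value of the divisor function, all but \<open>2 * y * (ln y) powr (1 - lam * ln 2)\<close> of the
  integers \<open>a \<le> y\<close> have at most \<open>lam * ln (ln y)\<close> prime factors; let \<open>G\<close> be the set of
  these. For \<open>k\<close> about \<open>3 * ln x / ln y\<close>, the \<open>k\<close>-th power of the sum of \<open>chi\<close> over \<open>G\<close> is a
  character sum of length \<open>y ^ k \<ge> x ^ 3\<close>, whose coefficient at \<open>n\<close> counts the factorizations of
  \<open>n\<close> into \<open>k\<close> elements of \<open>G\<close> and hence is at most a small power of \<open>x\<close>.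

  At this length no large sieve is needed: for primitive characters of different moduli
  \<open>q, q' \<le> x\<close> the product of one with the conjugate of the other is non-principal, so its
  incomplete sums are at most \<open>q * q' \<le> x\<^sup>2\<close>, and duality bounds the number of moduli with a
  large sum.
\<close>

section \<open>Near-orthogonality of primitive characters\<close>

lemma dirichlet_character_1: "dirichlet_character q chi \<Longrightarrow> chi 1 = 1"
  and dirichlet_character_mult: "dirichlet_character q chi \<Longrightarrow> chi (m * n) = chi m * chi n"
  and dirichlet_character_eq_0_iff: "dirichlet_character q chi \<Longrightarrow> chi n = 0 \<longleftrightarrow> \<not> coprime n q"
  and dirichlet_character_pos: "dirichlet_character q chi \<Longrightarrow> q > 0"
  by (auto simp: dirichlet_character_def)

lemma dirichlet_character_periodic:
  assumes "dirichlet_character q chi"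
  shows "chi (n + q * j) = chi n"
proof (induction j)
  case (Suc j)
  have "chi (n + q * Suc j) = chi ((n + q * j) + q)" by (simp add: algebra_simps)
  also have "\<dots> = chi n" using assms Suc by (simp add: dirichlet_character_def)
  finally show ?case .
qed simp

lemma dirichlet_character_cong:
  assumes "dirichlet_character q chi" "[m = n] (mod q)"
  shows "chi m = chi n"
proof -
  have "chi k = chi (k mod q)" for k
    using dirichlet_character_periodic[OF assms(1), of "k mod q" "k div q"] by simp
  then show ?thesis using assms(2) by (metis cong_def)
qed

lemma dirichlet_character_power:
  assumes "dirichlet_character q chi"
  shows "chi (n ^ j) = chi n ^ j"
  using assms by (induction j) (auto simp: dirichlet_character_mult dirichlet_character_1[unfolded One_nat_def])

text \<open>By Euler's theorem \<open>chi n\<close> is a root of unity of order dividing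
  \<open>totient q\<close> when \<open>n\<close> is coprime to \<open>q\<close>.\<close>

lemma dirichlet_character_norm:
  assumes "dirichlet_character q chi"
  shows "cmod (chi n) = (if coprime n q then 1 else 0)"
proof (cases "coprime n q")
  case True
  have "chi n ^ totient q = chi (n ^ totient q)"
    using dirichlet_character_power[OF assms] by simp
  also have "\<dots> = chi 1"
    using euler_theorem[OF True] by (intro dirichlet_character_cong[OF assms]) 
  finally have "cmod (chi n) ^ totient q = 1"
    using dirichlet_character_1[OF assms] by (metis norm_one norm_power)
  moreover have "totient q > 0" using dirichlet_character_pos[OF assms] by simp
  ultimately have "cmod (chi n) = 1"
    using power_eq_iff_eq_base[of "totient q" "cmod (chi n)" 1] by simp
  then show ?thesis using True by simp
next
  case False
  then show ?thesis using dirichlet_character_eq_0_iff[OF assms] by simp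
qed

lemma dirichlet_character_norm_le_1:
  "dirichlet_character q chi \<Longrightarrow> cmod (chi n) \<le> 1"
  by (simp add: dirichlet_character_norm)

section \<open>Distinguishing primitive characters of different moduli\<close>

text \<open>The congruence \<open>q * s = 1 - n\<close> modulo \<open>q'\<close> is solvable because
  \<open>gcd q q'\<close> divides \<open>1 - n\<close>. It is solved over the integers, where
  \<open>1 - n\<close> may be negative, and the solution is then reduced modulo \<open>q'\<close> to
  a natural number.\<close>

lemma cong_lift_gcd:
  fixes n q q' :: nat
  assumes "[n = 1] (mod gcd q q')" "q' > 0"
  obtains s where "[n + q * s = 1] (mod q')"
proof -
  have "[int n = 1] (mod (gcd (int q) (int q')))"
    using assms(1) by (metis cong_int_iff gcd_int_int_eq of_nat_1)
  then have "gcd (int q) (int q') dvd 1 - int n"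
    by (metis cong_iff_dvd_diff cong_sym)
  then obtain t where t: "[int q * t = 1 - int n] (mod int q')"
    using cong_solve_dvd_int by blast
  define s where "s = nat (t mod int q')"
  have s: "int s = t mod int q'" using assms(2) by (simp add: s_def)
  have "[int q * int s = int q * t] (mod int q')"
    unfolding s by (intro cong_scalar_left) simp
  then have "[int n + int q * int s = int n + (1 - int n)] (mod int q')"
    using t by (intro cong_add) (auto intro: cong_trans)
  then have "[int (n + q * s) = int 1] (mod int q')" by simp
  then have "[n + q * s = 1] (mod q')" using cong_int_iff by blast
  then show ?thesis using that by blast
qed

text \<open>Shifting \<open>n\<close> by a multiple of \<open>q\<close> keeps \<open>chi n\<close>
  and can make the argument 1 modulo \<open>q'\<close>, where \<open>chi'\<close> takes the value
  1.\<close>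

lemma induced_modulus_gcd:
  assumes "dirichlet_character q chi" "dirichlet_character q' chi'"
    and eq: "\<And>n. coprime n q \<Longrightarrow> coprime n q' \<Longrightarrow> chi n = chi' n"
  shows "induced_modulus q chi (gcd q q')"
  unfolding induced_modulus_def
proof (intro allI impI)
  fix n assume n: "coprime n q \<and> [n = 1] (mod gcd q q')"
  obtain s where s: "[n + q * s = 1] (mod q')"
    using cong_lift_gcd n dirichlet_character_pos[OF assms(2)] by blast
  have "coprime (n + q * s) q" using n
    by (metis cong_imp_coprime cong_add_lcancel_0_nat cong_mult_self_left cong_sym)
  moreover have "coprime (n + q * s) q'" using s by (metis cong_imp_coprime cong_sym coprime_1_left)
  ultimately have "chi (n + q * s) = chi' (n + q * s)" by (rule eq)
  also have "\<dots> = chi' 1" by (rule dirichlet_character_cong[OF assms(2) s])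
  also have "\<dots> = 1" using dirichlet_character_1[OF assms(2)] .
  finally show "chi n = 1" using dirichlet_character_periodic[OF assms(1)] by simp
qed

text \<open>Otherwise \<open>gcd q q'\<close> would be an induced modulus of both characters, and
  primitivity would force it to equal both \<open>q\<close> and \<open>q'\<close>.\<close>

lemma primitive_characters_differ:
  assumes "primitive_character q chi" "primitive_character q' chi'" "q \<noteq> q'"
  obtains n where "coprime n q" "coprime n q'" "chi n \<noteq> chi' n"
proof (rule ccontr)
  assume "\<not> thesis"
  then have eq: "\<And>n. coprime n q \<Longrightarrow> coprime n q' \<Longrightarrow> chi n = chi' n" using that by blast
  have c: "dirichlet_character q chi" "dirichlet_character q' chi'"
    using assms by (auto simp: primitive_character_def)
  note pos = c[THEN dirichlet_character_pos]
  have "induced_modulus q chi (gcd q q')" "induced_modulus q' chi' (gcd q q')"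
    using induced_modulus_gcd[OF c] induced_modulus_gcd[OF c(2,1)] eq by (auto simp: gcd.commute)
  then have "\<not> gcd q q' < q" "\<not> gcd q q' < q'"
    using assms by (auto simp: primitive_character_def)
  then show False using assms(3) pos
    by (metis gcd_le1_nat gcd_le2_nat le_antisym le_less_linear not_less_iff_gr_or_eq)
qed

section \<open>Incomplete sums and duality\<close>

text \<open>Strong induction strips off full periods, each summing to 0; fewer than \<open>M\<close>
  terms remain.\<close>

lemma periodic_sum_norm_le:
  fixes f :: "nat \<Rightarrow> complex"
  assumes per: "\<And>n. f (n + M) = f n" and zero: "(\<Sum>n<M. f n) = 0"
    and le: "\<And>n. cmod (f n) \<le> 1" and "M > 0"
  shows "cmod (\<Sum>n<N. f n) \<le> M"
proof (induction N rule: less_induct)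
  case (less N)
  show ?case
  proof (cases "N < M")
    case True
    have "cmod (\<Sum>n<N. f n) \<le> (\<Sum>n<N. 1)" using le by (intro sum_norm_le) auto
    then show ?thesis using True by simp
  next
    case False
    then have "{..<N} = {..<M} \<union> {M..<M + (N - M)}" by auto
    then have "(\<Sum>n<N. f n) = (\<Sum>n<M. f n) + (\<Sum>n\<in>{M..<M+(N-M)}. f n)"
      by (simp add: sum.union_disjoint ivl_disj_int)
    also have "(\<Sum>n\<in>{M..<M+(N-M)}. f n) = (\<Sum>n\<in>{0..<N-M}. f (n + M))"
      using sum.shift_bounds_nat_ivl[of f 0 M "N - M"] by (simp add: add.commute)
    finally have "(\<Sum>n<N. f n) = (\<Sum>n<N-M. f n)" using zero per by (simp add: lessThan_atLeast0)
    then show ?thesis using less[of "N - M"] False \<open>M > 0\<close> by simp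
  qed
qed

text \<open>The product \<open>f\<close> is completely multiplicative with period
  \<open>q * q'\<close>, and \<open>f a\<close> differs from 1 for some unit \<open>a\<close>.
  Multiplication by \<open>a\<close> permutes the residues, so the sum over a period is unchanged
  when multiplied by \<open>f a\<close> and hence vanishes.\<close>

lemma primitive_characters_inner_le:
  assumes "primitive_character q chi" "primitive_character q' chi'" "q \<noteq> q'"
  shows "cmod (\<Sum>n<N. chi n * cnj (chi' n)) \<le> q * q'"
proof -
  have c: "dirichlet_character q chi" "dirichlet_character q' chi'"
    using assms by (auto simp: primitive_character_def)
  note pos = c[THEN dirichlet_character_pos]
  define f where "f n = chi n * cnj (chi' n)" for n
  have le: "cmod (f n) \<le> 1" for n
    using c[THEN dirichlet_character_norm_le_1, of n] by (simp add: f_def norm_mult mult_le_one)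
  have f_cong: "f m = f n" if "[m = n] (mod (q * q'))" for m n
    using that c[THEN dirichlet_character_cong] unfolding f_def
    by (metis cong_modulus_mult_nat mult.commute)
  have f_mult: "f (m * n) = f m * f n" for m n
    by (simp add: f_def dirichlet_character_mult[OF c(1)] dirichlet_character_mult[OF c(2)])
  obtain a where a: "coprime a q" "coprime a q'" "chi a \<noteq> chi' a"
    using primitive_characters_differ assms by blast
  have co: "coprime a (q * q')" using a by simp
  have "cmod (chi' a) = 1" using a dirichlet_character_norm[OF c(2)] by simp
  then have "chi' a * cnj (chi' a) = 1" by (simp add: complex_norm_square[symmetric])
  then have fa: "f a \<noteq> 1" using a(3) unfolding f_def by (metis mult_cancel_right mult_zero_right zero_neq_one)
  define g where "g n = (a * n) mod (q * q')" for n
  have inj: "inj_on g {..<q*q'}"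
  proof (rule inj_onI)
    fix m n assume mn: "m \<in> {..<q*q'}" "n \<in> {..<q*q'}" "g m = g n"
    then have "[a * m = a * n] (mod (q * q'))" by (simp add: g_def cong_def)
    then have "[m = n] (mod (q * q'))" using co by (simp add: cong_mult_lcancel_nat)
    then show "m = n" using mn by (simp add: cong_def)
  qed
  have "g ` {..<q*q'} \<subseteq> {..<q*q'}" using pos by (auto simp: g_def)
  then have bij: "bij_betw g {..<q*q'} {..<q*q'}"
    using inj by (simp add: bij_betw_def endo_inj_surj)
  have "(\<Sum>n<q*q'. f n) = (\<Sum>n<q*q'. f (g n))"
    using sum.reindex_bij_betw[OF bij] by metis
  also have "\<dots> = (\<Sum>n<q*q'. f a * f n)"
    by (intro sum.cong) (auto simp: g_def f_mult[symmetric] cong_def intro!: f_cong)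
  also have "\<dots> = f a * (\<Sum>n<q*q'. f n)" by (simp add: sum_distrib_left)
  finally have "(1 - f a) * (\<Sum>n<q*q'. f n) = 0" by (simp add: algebra_simps)
  then have "(\<Sum>n<q*q'. f n) = 0" using fa by simp
  then have "cmod (\<Sum>n<N. f n) \<le> real (q * q')"
    using pos le by (intro periodic_sum_norm_le) (auto intro!: f_cong simp: cong_def)
  then show ?thesis by (simp add: f_def)
qed

text \<open>Duality: phases \<open>th q\<close> turn the sum of norms into a bilinear form,
  Cauchy-Schwarz separates off the coefficients \<open>r\<close>, and expanding the square of
  \<open>F\<close> leaves correlations of pairs of characters. The diagonal contributes
  \<open>N\<close> per modulus; the other pairs are nearly orthogonal.\<close>

lemma primitive_characters_mean_value:
  fixes chi :: "nat \<Rightarrow> nat \<Rightarrow> complex" and r :: "nat \<Rightarrow> real" and x :: real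
  assumes B: "finite B" "\<And>q. q \<in> B \<Longrightarrow> primitive_character q (chi q)" "\<And>q. q \<in> B \<Longrightarrow> real q \<le> x"
  shows "(\<Sum>q\<in>B. cmod (\<Sum>n<N. r n * chi q n))\<^sup>2
           \<le> (\<Sum>n<N. (r n)\<^sup>2) * (card B * N + (card B)\<^sup>2 * x\<^sup>2)"
proof -
  define S where "S q = (\<Sum>n<N. r n * chi q n)" for q
  \<comment> \<open>The conjugate phase of \<open>S q\<close>; it is 0 if \<open>S q\<close> is 0,
    so its norm is only bounded by 1.\<close>
  define th where "th q = cnj (sgn (S q))" for q
  define F where "F n = (\<Sum>q\<in>B. th q * chi q n)" for n
  have th_le: "cmod (th q) \<le> 1" for q by (simp add: th_def norm_sgn)
  have th_S: "th q * S q = of_real (cmod (S q))" for q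
  proof (cases "S q = 0")
    case False
    have "cnj (S q) * S q = of_real (cmod (S q)) * of_real (cmod (S q))"
      by (metis complex_norm_square mult.commute power2_eq_square of_real_power)
    then show ?thesis using False by (simp add: th_def sgn_div_norm scaleR_conv_of_real field_simps)
  qed simp
  have "of_real (\<Sum>q\<in>B. cmod (S q)) = (\<Sum>q\<in>B. th q * S q)" by (simp add: th_S)
  also have "\<dots> = (\<Sum>q\<in>B. \<Sum>n<N. r n * (th q * chi q n))"
    by (simp add: S_def sum_distrib_left algebra_simps)
  also have "\<dots> = (\<Sum>n<N. r n * F n)"
    by (subst sum.swap) (simp add: F_def sum_distrib_left)
  finally have "of_real (\<Sum>q\<in>B. cmod (S q)) = (\<Sum>n<N. r n * F n)" .
  then have "cmod (of_real (\<Sum>q\<in>B. cmod (S q))) = cmod (\<Sum>n<N. r n * F n)" by simp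
  also have "\<dots> \<le> (\<Sum>n<N. \<bar>r n\<bar> * cmod (F n))"
    by (intro sum_norm_le) (simp add: norm_mult)
  finally have "(\<Sum>q\<in>B. cmod (S q)) \<le> (\<Sum>n<N. \<bar>r n\<bar> * cmod (F n))"
    by (simp only: norm_of_real)
  then have "(\<Sum>q\<in>B. cmod (S q))\<^sup>2 \<le> (\<Sum>n<N. \<bar>r n\<bar> * cmod (F n))\<^sup>2"
    by (intro power_mono sum_nonneg) auto
  also have "\<dots> \<le> (\<Sum>n<N. \<bar>r n\<bar>\<^sup>2) * (\<Sum>n<N. (cmod (F n))\<^sup>2)" by (rule Cauchy_Schwarz_ineq_sum)
  finally have 1: "(\<Sum>q\<in>B. cmod (S q))\<^sup>2 \<le> (\<Sum>n<N. (r n)\<^sup>2) * (\<Sum>n<N. (cmod (F n))\<^sup>2)" by simp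
  have "of_real (\<Sum>n<N. (cmod (F n))\<^sup>2) = (\<Sum>n<N. F n * cnj (F n))"
    by (simp add: complex_norm_square[symmetric])
  also have "\<dots> = (\<Sum>n<N. \<Sum>q\<in>B. \<Sum>q'\<in>B. th q * cnj (th q') * (chi q n * cnj (chi q' n)))"
    by (simp add: F_def sum_product algebra_simps)
  also have "\<dots> = (\<Sum>q\<in>B. \<Sum>q'\<in>B. \<Sum>n<N. th q * cnj (th q') * (chi q n * cnj (chi q' n)))"
    by (simp only: sum.swap[of _ B "{..<N}"])
  also have "\<dots> = (\<Sum>q\<in>B. \<Sum>q'\<in>B. th q * cnj (th q') * (\<Sum>n<N. chi q n * cnj (chi q' n)))"
    by (simp add: sum_distrib_left)
  finally have "cmod (of_real (\<Sum>n<N. (cmod (F n))\<^sup>2)) =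
      cmod (\<Sum>q\<in>B. \<Sum>q'\<in>B. th q * cnj (th q') * (\<Sum>n<N. chi q n * cnj (chi q' n)))" by simp
  \<comment> \<open>The term \<open>x\<^sup>2\<close> is granted to diagonal pairs too, so that the
    double sum has a simple closed form.\<close>
  also have "\<dots> \<le> (\<Sum>q\<in>B. \<Sum>q'\<in>B. (if q = q' then real N else 0) + x\<^sup>2)"
  proof (intro sum_norm_le)
    fix q q' assume q: "q \<in> B" "q' \<in> B"
    have c: "dirichlet_character q (chi q)" "dirichlet_character q' (chi q')"
      using B(2) q by (auto simp: primitive_character_def)
    have "cmod (\<Sum>n<N. chi q n * cnj (chi q' n)) \<le> (if q = q' then real N else 0) + x\<^sup>2"
    proof (cases "q = q'")
      case True
      have "cmod (\<Sum>n<N. chi q n * cnj (chi q' n)) \<le> (\<Sum>n<N. 1)"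
      proof (intro sum_norm_le)
        fix n show "cmod (chi q n * cnj (chi q' n)) \<le> 1"
          using c[THEN dirichlet_character_norm_le_1, of n] by (simp add: norm_mult mult_le_one)
      qed
      then show ?thesis using True by (simp add: add_increasing2)
    next
      case False
      have "cmod (\<Sum>n<N. chi q n * cnj (chi q' n)) \<le> real q * real q'"
        using primitive_characters_inner_le[OF B(2)[OF q(1)] B(2)[OF q(2)] False] by simp
      also have "\<dots> \<le> x * x" using B(3) q by (intro mult_mono) (auto intro: order_trans[of 0 "real q"])
      finally show ?thesis using False by (simp add: power2_eq_square)
    qed
    moreover have "cmod (th q) * cmod (th q') \<le> 1" using th_le by (simp add: mult_le_one)
    ultimately show "cmod (th q * cnj (th q') * (\<Sum>n<N. chi q n * cnj (chi q' n)))
        \<le> (if q = q' then real N else 0) + x\<^sup>2"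
      unfolding norm_mult complex_mod_cnj
      by (meson mult_left_le_one_le mult_nonneg_nonneg norm_ge_zero order_trans)
  qed
  also have "\<dots> = card B * N + (card B)\<^sup>2 * x\<^sup>2"
    using B(1) by (simp add: sum.distrib power2_eq_square algebra_simps)
  finally have "(\<Sum>n<N. (cmod (F n))\<^sup>2) \<le> card B * N + (card B)\<^sup>2 * x\<^sup>2"
    by (simp only: norm_of_real)
  then have "(\<Sum>n<N. (r n)\<^sup>2) * (\<Sum>n<N. (cmod (F n))\<^sup>2) \<le> (\<Sum>n<N. (r n)\<^sup>2) * (card B * N + (card B)\<^sup>2 * x\<^sup>2)"
    by (intro mult_left_mono sum_nonneg) auto
  then show ?thesis using 1 by (simp add: S_def)
qed

section \<open>Integers with few prime factors\<close>

lemma sum_power_eq_sum_PiE: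
  fixes chi :: "nat \<Rightarrow> 'a::comm_semiring_1"
  assumes "finite G" and one: "chi 1 = 1" and mult: "\<And>m n. chi (m * n) = chi m * chi n"
  shows "(\<Sum>a\<in>G. chi a) ^ k = (\<Sum>g\<in>({..<k} \<rightarrow>\<^sub>E G). chi (\<Prod>i<k. g i))"
proof -
  have prod: "chi (prod g A) = (\<Prod>i\<in>A. chi (g i))" if "finite A" for A and g :: "nat \<Rightarrow> nat"
    using that by induction (use one mult in auto)
  have "(\<Sum>a\<in>G. chi a) ^ k = (\<Prod>i<k. \<Sum>a\<in>G. chi a)" by simp
  also have "\<dots> = (\<Sum>g\<in>({..<k} \<rightarrow>\<^sub>E G). \<Prod>i<k. chi (g i))"
    using assms(1) by (intro prod_sum_PiE) auto
  finally show ?thesis by (simp add: prod)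
qed

text \<open>Ordered factorizations, coded as extensional functions so that each tuple is counted
  exactly once.\<close>

definition factorizations :: "nat \<Rightarrow> nat set \<Rightarrow> nat \<Rightarrow> (nat \<Rightarrow> nat) set" where
  "factorizations k G n = {g \<in> {..<k} \<rightarrow>\<^sub>E G. (\<Prod>i<k. g i) = n}"

lemma finite_factorizations [simp]: "finite G \<Longrightarrow> finite (factorizations k G n)"
  unfolding factorizations_def by (rule finite_subset[of _ "{..<k} \<rightarrow>\<^sub>E G"]) (auto intro: finite_PiE)

lemma sum_PiE_by_product:
  fixes h :: "nat \<Rightarrow> 'a::comm_semiring_1"
  assumes "finite G" and lt: "\<And>g. g \<in> {..<k} \<rightarrow>\<^sub>E G \<Longrightarrow> (\<Prod>i<k. g i) < N"
  shows "(\<Sum>g\<in>({..<k} \<rightarrow>\<^sub>E G). h (\<Prod>i<k. g i)) = (\<Sum>n<N. of_nat (card (factorizations k G n)) * h n)"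
proof -
  have "(\<Sum>g\<in>({..<k} \<rightarrow>\<^sub>E G). h (\<Prod>i<k. g i))
      = (\<Sum>n<N. \<Sum>g\<in>factorizations k G n. h (\<Prod>i<k. g i))"
    unfolding factorizations_def using assms
    by (intro sum.group[symmetric]) (auto intro!: finite_PiE)
  also have "\<dots> = (\<Sum>n<N. of_nat (card (factorizations k G n)) * h n)"
    by (intro sum.cong refl) (simp add: factorizations_def)
  finally show ?thesis .
qed

lemma sum_card_factorizations:
  assumes "finite G" "\<And>g. g \<in> {..<k} \<rightarrow>\<^sub>E G \<Longrightarrow> (\<Prod>i<k. g i) < N"
  shows "(\<Sum>n<N. card (factorizations k G n)) = card G ^ k"
  using sum_PiE_by_product[OF assms, of "\<lambda>_. 1 :: nat"] by (simp add: card_PiE)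

text \<open>Every factor divides \<open>n\<close>, so each of the \<open>k\<close> coordinates has
  at most as many choices as \<open>n\<close> has divisors in \<open>G\<close>.\<close>

lemma card_factorizations_le:
  assumes "finite G"
  shows "card (factorizations k G n) \<le> card {a \<in> G. a dvd n} ^ k"
proof -
  have "factorizations k G n \<subseteq> {..<k} \<rightarrow>\<^sub>E {a \<in> G. a dvd n}"
    by (auto simp: factorizations_def PiE_def Pi_def)
  then have "card (factorizations k G n) \<le> card ({..<k} \<rightarrow>\<^sub>E {a \<in> G. a dvd n})"
    using assms by (intro card_mono finite_PiE) auto
  then show ?thesis by (simp add: card_PiE)
qed

section \<open>Counting integers with few prime factors\<close>

text \<open>Induction on \<open>l\<close>, splitting off the full power of one prime
  \<open>p\<close>, so that the cofactor has one prime factor fewer. Its exponent is below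
  \<open>v\<close> because powers of 2 with that exponent stay below \<open>2 ^ v\<close>.
  Finiteness is carried along because the comparison of cardinalities needs it.\<close>

lemma card_few_prime_factors_le:
  fixes P :: "nat set"
  assumes "finite P"
  shows "finite {a. 0 < a \<and> a < 2 ^ v \<and> prime_factors a \<subseteq> P \<and> card (prime_factors a) \<le> l} \<and>
    card {a. 0 < a \<and> a < 2 ^ v \<and> prime_factors a \<subseteq> P \<and> card (prime_factors a) \<le> l}
      \<le> (1 + card P * v) ^ l"
proof (induction l)
  case 0
  have "{a. 0 < a \<and> a < 2 ^ v \<and> prime_factors a \<subseteq> P \<and> card (prime_factors a) \<le> 0} \<subseteq> {1::nat}"
    using prime_factorization_empty_iff[where 'a = nat] by auto
  then show ?case using card_mono[of "{1::nat}"] finite_subset by fastforce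
next
  case (Suc l)
  define A where "A l = {a. 0 < a \<and> a < 2 ^ v \<and> prime_factors a \<subseteq> P \<and> card (prime_factors a) \<le> l}" for l
  \<comment> \<open>The possible split-off factors. The extra element 1 serves \<open>a = 1\<close>,
    which has no prime to split off.\<close>
  define Q where "Q = insert 1 ((\<lambda>(p, e). p ^ Suc e) ` (P \<times> {..<v}))"
  have "card Q \<le> Suc (card ((\<lambda>(p, e). p ^ Suc e) ` (P \<times> {..<v})))"
    unfolding Q_def using assms by (intro card_insert_le_m1) (auto simp: card_insert_if)
  also have "card ((\<lambda>(p, e). p ^ Suc e) ` (P \<times> {..<v})) \<le> card P * v"
    using card_image_le[of "P \<times> {..<v}"] assms by (simp add: card_cartesian_product)
  finally have Q: "card Q \<le> 1 + card P * v" "finite Q" using assms by (auto simp: Q_def)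
  have "A (Suc l) \<subseteq> (\<lambda>(s, b). s * b) ` (Q \<times> A l)"
  proof
    fix a assume a: "a \<in> A (Suc l)"
    show "a \<in> (\<lambda>(s, b). s * b) ` (Q \<times> A l)"
    proof (cases "prime_factors a = {}")
      case True
      then have "a \<in> A l" using a by (simp add: A_def)
      then show ?thesis by (intro image_eqI[of _ _ "(1, a)"]) (auto simp: Q_def)
    next
      case False
      then obtain p where p: "p \<in> prime_factors a" by blast
      then have pp: "prime p" "p dvd a" by auto
      obtain b where b: "a = p ^ multiplicity p a * b" "\<not> p dvd b"
        using multiplicity_decompose'[of a p] a pp not_prime_1 by (metis (no_types, lifting) A_def mem_Collect_eq not_prime_unit less_not_refl)
      have a0: "a > 0" "a < 2 ^ v" using a by (auto simp: A_def)
      have m: "multiplicity p a > 0" using p by (simp add: prime_factors_multiplicity)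
      then obtain e where e: "multiplicity p a = Suc e" using gr0_implies_Suc by blast
      have b0: "b > 0" using b a0 by (metis gr0I mult_0_right)
      have "2 ^ Suc e \<le> p ^ Suc e" using pp prime_ge_2_nat by (intro power_mono) auto
      also have "\<dots> \<le> a" using b(1) e a0 by (metis dvd_imp_le dvd_triv_left)
      finally have "(2::nat) ^ Suc e < 2 ^ v" using a0 by simp
      then have "Suc e < v" by (simp only: power_strict_increasing_iff one_less_numeral_iff semiring_norm)
      then have 1: "p ^ multiplicity p a \<in> Q" using p a e by (auto simp: Q_def A_def)
      have pf: "prime_factors a = insert p (prime_factors b)"
        using b0 b(1) pp m
        by (metis prime_factors_product prime_factors_power prime_prime_factors insert_is_Un
            not_gr_zero power_eq_0_iff prime_gt_0_nat)
      moreover have "p \<notin> prime_factors b" using b by auto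
      ultimately have "card (prime_factors b) \<le> l" using a by (simp add: A_def)
      moreover have "b \<le> a" using b(1) a0 by (metis dvd_imp_le dvd_triv_right)
      ultimately have 2: "b \<in> A l" using pf a b0 by (auto simp: A_def)
      show ?thesis using 1 2 b(1) by (intro image_eqI[of _ _ "(p ^ multiplicity p a, b)"]) auto
    qed
  qed
  moreover have fin: "finite (A l)" and le: "card (A l) \<le> (1 + card P * v) ^ l"
    using Suc by (simp_all add: A_def)
  ultimately have "finite (A (Suc l))" "card (A (Suc l)) \<le> card (Q \<times> A l)"
    using Q surj_card_le[of "Q \<times> A l" "A (Suc l)" "\<lambda>(s, b). s * b"]
    by (auto intro: finite_subset)
  moreover have "card (Q \<times> A l) \<le> (1 + card P * v) * (1 + card P * v) ^ l"
    unfolding card_cartesian_product using Q le by (intro mult_mono) auto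
  ultimately show ?case by (simp add: A_def)
qed

text \<open>A product of \<open>k\<close> elements of \<open>G\<close> has at most
  \<open>k * l\<close> distinct primes, which bounds the number of its divisors in \<open>G\<close>;
  the \<open>k\<close> coordinates are then chosen independently. If there is no factorization, the
  bound is trivial.\<close>

lemma card_factorizations_few_prime_factors_le:
  assumes G: "G \<subseteq> {a. 0 < a \<and> a < 2 ^ v \<and> card (prime_factors a) \<le> l}"
  shows "card (factorizations k G n) \<le> (1 + k * l * v) ^ (k * l)"
proof (cases "factorizations k G n = {}")
  case False
  then obtain g where g: "g \<in> {..<k} \<rightarrow>\<^sub>E G" "(\<Prod>i<k. g i) = n"
    by (auto simp: factorizations_def)
  have gi: "g i \<in> G" if "i < k" for i using g that by (auto simp: PiE_iff)
  have n0: "n \<noteq> 0" using g(2) gi G by fastforce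
  have finG: "finite G" using G by (rule finite_subset) auto
  have "prime_factors n = (\<Union>i<k. prime_factors (g i))"
    using gi G by (subst g(2)[symmetric], subst prime_factors_prod) (force simp: image_iff)+
  also have "card \<dots> \<le> (\<Sum>i<k. card (prime_factors (g i)))" by (intro card_UN_le) auto
  also have "\<dots> \<le> (\<Sum>i<k. l)" using gi G by (intro sum_mono) force
  finally have n: "card (prime_factors n) \<le> k * l" by simp
  define D where "D = {a. 0 < a \<and> a < 2 ^ v \<and> prime_factors a \<subseteq> prime_factors n \<and> card (prime_factors a) \<le> l}"
  have D: "finite D" "card D \<le> (1 + card (prime_factors n) * v) ^ l"
    using card_few_prime_factors_le[of "prime_factors n" v l] by (auto simp: D_def)
  have "{a \<in> G. a dvd n} \<subseteq> D" using G n0 dvd_prime_factors[of n] unfolding D_def by blast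
  then have "card {a \<in> G. a dvd n} \<le> card D" using D by (intro card_mono)
  also note D(2)
  also have "(1 + card (prime_factors n) * v) ^ l \<le> (1 + k * l * v) ^ l"
    using n by (intro power_mono add_left_mono mult_right_mono) auto
  finally have "card {a \<in> G. a dvd n} ^ k \<le> ((1 + k * l * v) ^ l) ^ k" by (intro power_mono) auto
  also have "\<dots> = (1 + k * l * v) ^ (k * l)" by (simp add: power_mult[symmetric] mult.commute)
  finally show ?thesis using card_factorizations_le[OF finG, of k n] by linarith
qed simp

section \<open>The divisor function and integers with many prime factors\<close>

text \<open>Different sets of primes dividing \<open>n\<close> have different products, and these
  squarefree products divide \<open>n\<close>.\<close>

lemma two_power_card_prime_factors_le:
  fixes n :: nat
  assumes "n > 0"
  shows "2 ^ card (prime_factors n) \<le> card {d. d dvd n}"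
proof -
  have pf: "prime_factors (\<Prod>A) = A" if "A \<subseteq> prime_factors n" for A
  proof -
    have "finite A" using that finite_subset by auto
    moreover have "\<forall>p\<in>A. prime p" using that by auto
    ultimately show ?thesis
      by (subst prime_factors_prod) (auto simp: prime_prime_factors intro: ccontr)
  qed
  have "inj_on Prod (Pow (prime_factors n))"
    by (rule inj_on_inverseI[of _ prime_factors]) (use pf in auto)
  moreover have "Prod ` Pow (prime_factors n) \<subseteq> {d. d dvd n}"
  proof safe
    fix A assume A: "A \<subseteq> prime_factors n"
    have "\<Prod>A dvd \<Prod>(prime_factors n)" using A by (intro prod_dvd_prod_subset) auto
    also have "\<dots> dvd (\<Prod>p\<in>prime_factors n. p ^ multiplicity p n)"
      by (intro prod_dvd_prod) (auto simp: prime_factors_multiplicity intro: dvd_power)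
    also have "\<dots> = n" using assms by (simp add: prime_factorization_nat[symmetric])
    finally show "\<Prod>A dvd n" .
  qed
  ultimately have "card (Pow (prime_factors n)) \<le> card {d. d dvd n}"
    using assms by (intro card_inj_on_le) auto
  then show ?thesis by (simp add: card_Pow)
qed

text \<open>After exchanging the summations, each \<open>d\<close> is counted \<open>Y div d\<close>
  times, which leads to a harmonic sum.\<close>

lemma sum_card_divisors_le:
  fixes Y :: nat
  assumes "Y > 0"
  shows "(\<Sum>n=1..Y. real (card {d. d dvd n})) \<le> Y * (1 + ln Y)"
proof -
  have "(\<Sum>n=1..Y. card {d. d dvd n}) = (\<Sum>n=1..Y. card {d\<in>{1..Y}. d dvd n})"
    by (intro sum.cong arg_cong[of _ _ card] Collect_cong) (auto dest: dvd_imp_le intro!: Suc_leI gr0I)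
  also have "\<dots> = (\<Sum>d=1..Y. card {n\<in>{1..Y}. d dvd n})"
    by (intro sum_multicount_gen) auto
  also have "\<dots> = (\<Sum>d=1..Y. Y div d)"
  proof (intro sum.cong refl)
    fix d assume d: "d \<in> {1..Y}"
    have "{n\<in>{1..Y}. d dvd n} = (\<lambda>j. d * j) ` {1..Y div d}"
    proof (intro equalityI subsetI)
      fix n assume "n \<in> {n\<in>{1..Y}. d dvd n}"
      then obtain j where "n = d * j" "1 \<le> n" "n \<le> Y" by auto
      then show "n \<in> (\<lambda>j. d * j) ` {1..Y div d}" using d
        by (intro image_eqI[of _ _ j]) (auto simp: less_eq_div_iff_mult_less_eq mult.commute intro: Suc_leI gr0I)
    next
      fix n assume "n \<in> (\<lambda>j. d * j) ` {1..Y div d}"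
      then show "n \<in> {n\<in>{1..Y}. d dvd n}" using d
        by (auto simp: less_eq_div_iff_mult_less_eq mult.commute)
    qed
    then show "card {n\<in>{1..Y}. d dvd n} = Y div d"
      using d by (simp add: card_image inj_on_def)
  qed
  finally have "(\<Sum>n=1..Y. real (card {d. d dvd n})) = (\<Sum>d=1..Y. real (Y div d))"
    by (metis (mono_tags, lifting) of_nat_sum sum.cong)
  also have "\<dots> \<le> (\<Sum>d=1..Y. real Y / real d)"
    by (intro sum_mono) (simp add: of_nat_div_le_of_nat)
  also have "\<dots> = Y * harm Y" by (simp add: harm_def sum_distrib_left divide_inverse)
  \<comment> \<open>The sequence \<open>harm n - ln n\<close> decreases from its value 1 at
    \<open>n = 1\<close>.\<close>
  also have "\<dots> \<le> Y * (1 + ln Y)"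
    using euler_mascheroni_sequence_decreasing[of 1 Y] assms
    by (intro mult_left_mono) (auto simp: harm_expand)
  finally show ?thesis .
qed

text \<open>Markov's inequality for the divisor function: each integer counted has at least
  \<open>2 powr l\<close> divisors.\<close>

lemma card_many_prime_factors_le:
  fixes l :: real and Y :: nat
  assumes "Y > 0"
  shows "card {a \<in> {1..Y}. card (prime_factors a) > l} * 2 powr l \<le> Y * (1 + ln Y)"
proof -
  have "card {a \<in> {1..Y}. card (prime_factors a) > l} * 2 powr l
      = (\<Sum>a | a \<in> {1..Y} \<and> card (prime_factors a) > l. 2 powr l)" by simp
  also have "\<dots> \<le> (\<Sum>a | a \<in> {1..Y} \<and> card (prime_factors a) > l. real (card {d. d dvd a}))"
  proof (intro sum_mono)
    fix a assume "a \<in> {a. a \<in> {1..Y} \<and> card (prime_factors a) > l}"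
    then have a: "a > 0" "l < card (prime_factors a)" by auto
    have "2 powr l \<le> 2 powr card (prime_factors a)" using a by (intro powr_mono) auto
    also have "\<dots> = 2 ^ card (prime_factors a)" by (simp add: powr_realpow)
    also have "\<dots> \<le> card {d. d dvd a}"
      using two_power_card_prime_factors_le[OF a(1)] by (metis of_nat_le_iff of_nat_numeral of_nat_power)
    finally show "2 powr l \<le> card {d. d dvd a}" .
  qed
  also have "\<dots> \<le> (\<Sum>a=1..Y. real (card {d. d dvd a}))" by (intro sum_mono2) auto
  also have "\<dots> \<le> Y * (1 + ln Y)" by (rule sum_card_divisors_le[OF assms])
  finally show ?thesis .
qed

section \<open>Moduli with large character sums\<close>

text \<open>The mean value estimate is applied to the \<open>k\<close>-th powers of the sums over
  \<open>G\<close>, whose coefficients \<open>r n\<close> are numbers of factorizations. The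
  hypothesis on \<open>y ^ k\<close> makes the off-diagonal part no larger than the diagonal scale,
  and one factor \<open>card B\<close> cancels.\<close>

lemma card_large_values_le:
  fixes chi :: "nat \<Rightarrow> nat \<Rightarrow> complex" and x y V :: real
  assumes B: "finite B" "\<And>q. q \<in> B \<Longrightarrow> primitive_character q (chi q)" "\<And>q. q \<in> B \<Longrightarrow> real q \<le> x"
    and G: "G \<subseteq> {a. 0 < a \<and> a < 2 ^ v \<and> card (prime_factors a) \<le> l}" "\<And>a. a \<in> G \<Longrightarrow> real a \<le> y"
    and V: "V \<ge> 0" "\<And>q. q \<in> B \<Longrightarrow> V \<le> cmod (\<Sum>a\<in>G. chi q a)"
    and y: "y \<ge> 1" "card B * x\<^sup>2 \<le> y ^ k"
  shows "card B * V ^ (2 * k) \<le> 3 * real ((1 + k * l * v) ^ (k * l)) * y ^ (2 * k)"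
proof (cases "card B = 0")
  case False
  \<comment> \<open>The summand 1 lets \<open>n < N\<close> cover all products up to
    \<open>y ^ k\<close>.\<close>
  define N where "N = nat \<lfloor>y ^ k\<rfloor> + 1"
  define r where "r n = card (factorizations k G n)" for n
  define R where "R = (1 + k * l * v) ^ (k * l)"
  have finG: "finite G" using G(1) by (rule finite_subset) auto
  have yk: "1 \<le> y ^ k" using y by simp
  have N_le: "real N \<le> 2 * y ^ k" using yk unfolding N_def by linarith
  have lt: "(\<Prod>i<k. g i) < N" if g: "g \<in> {..<k} \<rightarrow>\<^sub>E G" for g
  proof -
    have "real (\<Prod>i<k. g i) \<le> (\<Prod>i<k. y)"
      unfolding of_nat_prod using g G(2) by (intro prod_mono) (auto simp: PiE_iff)
    then have "real (\<Prod>i<k. g i) \<le> y ^ k" by simp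
    then show ?thesis unfolding N_def using yk by linarith
  qed
  have "G \<subseteq> {1..nat \<lfloor>y\<rfloor>}"
    using G by (force simp: le_nat_floor Suc_le_eq)
  then have "card G \<le> nat \<lfloor>y\<rfloor>" using card_mono[of "{1..nat \<lfloor>y\<rfloor>}" G] by simp
  then have cG: "real (card G) \<le> y" using y(1) by linarith
  \<comment> \<open>One factor \<open>r n\<close> is bounded by the maximum \<open>R\<close>; the
    other sums to the number of all tuples.\<close>
  have "(\<Sum>n<N. (real (r n))\<^sup>2) \<le> (\<Sum>n<N. real R * real (r n))"
    unfolding power2_eq_square r_def R_def
    using card_factorizations_few_prime_factors_le[OF G(1), of k]
    by (intro sum_mono mult_right_mono) (auto simp del: of_nat_power)
  also have "\<dots> = real R * real (\<Sum>n<N. r n)" by (simp add: sum_distrib_left)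
  also have "\<dots> = real R * real (card G) ^ k"
    using sum_card_factorizations[OF finG lt] by (simp add: r_def)
  also have "\<dots> \<le> real R * y ^ k" using cG by (intro mult_left_mono power_mono) auto
  finally have r2: "(\<Sum>n<N. (real (r n))\<^sup>2) \<le> real R * y ^ k" .
  have S: "(\<Sum>n<N. of_real (real (r n)) * chi q n) = (\<Sum>a\<in>G. chi q a) ^ k" if "q \<in> B" for q
  proof -
    have c: "dirichlet_character q (chi q)" using B(2) that by (simp add: primitive_character_def)
    show ?thesis
      unfolding sum_power_eq_sum_PiE[of G "chi q", OF finG dirichlet_character_1[OF c] dirichlet_character_mult[OF c]]
      by (subst sum_PiE_by_product[OF finG lt]) (auto simp: r_def)
  qed
  have "real (card B) * V ^ k = (\<Sum>q\<in>B. V ^ k)" by simp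
  also have "\<dots> \<le> (\<Sum>q\<in>B. cmod (\<Sum>n<N. of_real (real (r n)) * chi q n))"
    using V by (intro sum_mono, subst S) (auto simp: norm_power intro: power_mono)
  finally have "(real (card B) * V ^ k)\<^sup>2 \<le> (\<Sum>q\<in>B. cmod (\<Sum>n<N. of_real (real (r n)) * chi q n))\<^sup>2"
    using V by (intro power_mono) auto
  also have "\<dots> \<le> (\<Sum>n<N. (real (r n))\<^sup>2) * (card B * N + (card B)\<^sup>2 * x\<^sup>2)"
    by (rule primitive_characters_mean_value[OF B])
  also have "\<dots> \<le> (real R * y ^ k) * (card B * (3 * y ^ k))"
  proof (rule mult_mono[OF r2])
    have "real (card B) * (real N + card B * x\<^sup>2) \<le> card B * (3 * y ^ k)"
      using N_le y(2) by (intro mult_left_mono) auto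
    then show "real (card B * N) + real ((card B)\<^sup>2) * x\<^sup>2 \<le> card B * (3 * y ^ k)"
      by (simp add: power2_eq_square algebra_simps)
  qed (use y in auto)
  finally have "real (card B) * (real (card B) * V ^ (2 * k)) \<le> real (card B) * (3 * real R * y ^ (2 * k))"
    by (simp add: power_mult power2_eq_square power_mult_distrib mult_2 power_add algebra_simps)
  then have "real (card B) * V ^ (2 * k) \<le> 3 * real R * y ^ (2 * k)" using False by simp
  then show ?thesis by (simp add: R_def)
qed (use y in simp)

section \<open>Estimates for the choice of parameters\<close>

text \<open>The function \<open>z / ln z\<close> is increasing, so it suffices to compare at \<open>z = 20 * w * ln w\<close>,
  where the factor \<open>ln (20 * w * ln w) / ln w\<close> must not exceed \<open>0.49 * 20 / 8 = 1.225\<close>.\<close>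
lemma eight_mult_ln_le:
  fixes w z :: real
  assumes w: "w > 0" "ln w \<ge> 40" and z: "20 * w * ln w \<le> z"
  shows "8 * w * ln z \<le> 0.49 * z"
proof -
  define s where "s = ln w"
  define c where "c = 20 * w * s"
  have s: "s \<ge> 40" using w by (simp add: s_def)
  have c: "c > 0" using w s by (simp add: c_def)
  have zc: "z \<ge> c" using z by (simp add: c_def s_def)
  \<comment> \<open>Scaling by \<open>2 ^ 11\<close> leaves only \<open>20 / 2048\<close> as
    coefficient of \<open>s\<close>, while the constant \<open>11 * ln 2 - 1 < 6.7\<close> is below
    \<open>0.17 * s\<close> as \<open>s \<ge> 40\<close>.\<close>
  have "ln (20 * s / 2 ^ 11) \<le> 20 * s / 2 ^ 11 - 1" using s by (intro ln_le_minus_one) auto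
  moreover have "ln (20 * s / 2 ^ 11) = ln (20 * s) - 11 * ln 2"
    using s ln_realpow[of "2 :: real" 11] by (subst ln_div) auto
  ultimately have "ln (20 * s) \<le> 0.225 * s" using s ln2_le_25_over_36 by simp
  moreover have "ln c = ln (20 * s) + s"
    using w s by (simp add: c_def s_def ln_mult)
  moreover have "ln (20 * s) \<ge> 0" using s by simp
  ultimately have lnc: "ln c \<ge> 1" "ln c \<le> 1.225 * s" using s by (linarith, simp)
  define m where "m = z / c"
  have m: "m \<ge> 1" "z = m * c" using zc c by (auto simp: m_def)
  have "ln z = ln m + ln c" using m c by (simp add: ln_mult)
  also have "\<dots> \<le> m - 1 + ln c" using ln_le_minus_one[of m] m by simp
  also have "\<dots> \<le> m * ln c"
    using mult_nonneg_nonneg[of "m - 1" "ln c - 1"] m lnc by (simp add: algebra_simps)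
  also have "\<dots> \<le> m * (1.225 * s)" using m lnc by (intro mult_left_mono) auto
  finally have "8 * w * ln z \<le> 8 * w * (m * (1.225 * s))" using w by (intro mult_left_mono) auto
  also have "\<dots> = 0.49 * z" using m by (simp add: c_def)
  finally show ?thesis .
qed

text \<open>With \<open>X = ln x\<close>, \<open>z = ln y\<close>, \<open>t = ln z\<close>,
  \<open>u = ln X\<close>, the product is at most \<open>exp (k * lam * t * ln (36 * b))\<close>
  with \<open>b = lam * t * X\<close>. Since \<open>k \<le> 4 * X / z\<close> and
  \<open>ln (36 * b) \<le> 2 * u\<close>, the exponent is at most
  \<open>X / z * (8 * w * t)\<close>, and the lower bound on \<open>ln y\<close> gives
  \<open>8 * w * t \<le> 0.49 * z\<close>.\<close>

lemma exponent_le: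
  fixes x y lam :: real
  defines "k \<equiv> nat \<lceil>3 * ln x / ln y\<rceil>" and "l \<equiv> nat \<lfloor>lam * ln (ln y)\<rfloor>"
    and "v \<equiv> nat \<lfloor>log 2 y\<rfloor> + 1"
  assumes x: "x > 1" "ln (ln x) \<ge> exp 40" and lam: "lam \<ge> 3" and y: "y > 1" "y \<le> x"
    and ly: "20 * lam * ln (lam * ln (ln x)) * ln (ln x) \<le> ln y"
  shows "real ((1 + k * l * v) ^ (k * l)) * (ln y powr (lam * ln 2 - 1)) ^ (2 * k) \<le> x powr 0.49"
    and "x ^ 3 \<le> y ^ k" and "ln y \<ge> 2"
proof -
  define X where "X = ln x"
  define u where "u = ln X"
  define z where "z = ln y"
  define t where "t = ln z"
  define w where "w = lam * u"
  have u: "u \<ge> exp 40" using x by (simp add: u_def X_def)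
  have u1: "u \<ge> 41" using u exp_ge_add_one_self[of 40] by linarith
  have X0: "X > 0" using x by (simp add: X_def)
  have zX: "z \<le> X" using y by (simp add: z_def X_def)
  have wu: "w \<ge> 1 * u" unfolding w_def using lam u1 by (intro mult_right_mono) auto
  have w0: "w > 0" using wu u1 by simp
  have lnw: "ln w \<ge> 40"
    using w0 wu u ln_ge_iff[of w 40] by simp
  have wz: "20 * w * ln w \<le> z" using ly by (simp add: w_def u_def X_def z_def algebra_simps)
  have "20 * w * 40 \<le> 20 * w * ln w" using w0 lnw by (intro mult_left_mono) auto
  then have wz': "800 * w \<le> z" using wz by simp
  then have z0: "z \<ge> 41 * 800" using wu u1 by linarith
  then show "ln y \<ge> 2" by (simp add: z_def)
  have t0: "t \<ge> 1" using z0 exp_le ln_ge_iff[of z 1] by (simp add: t_def)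
  have tu: "t \<le> u" using zX z0 by (simp add: t_def u_def)
  have k1: "3 * X / z \<le> k" unfolding k_def X_def z_def by linarith
  \<comment> \<open>Rounding up costs at most 1, which is at most \<open>X / z\<close> because
    \<open>y \<le> x\<close>.\<close>
  have "k \<le> 3 * X / z + 1" unfolding k_def X_def[symmetric] z_def[symmetric]
    using X0 z0 by (simp add: divide_nonneg_pos ceiling_correct)
  also have "\<dots> \<le> 4 * X / z" using zX z0 by (simp add: field_simps)
  finally have k2: "k \<le> 4 * X / z" .
  have "ln (x ^ 3) \<le> ln (y ^ k)"
    using k1 z0 x y by (simp add: ln_realpow X_def[symmetric] z_def[symmetric] field_simps)
  then show "x ^ 3 \<le> y ^ k" using x y by simp
  have lt: "l \<le> lam * t" unfolding l_def t_def[symmetric] z_def[symmetric]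
    using lam t0 by simp
  have "log 2 y \<le> 3 / 2 * z"
    using ln2_ge_two_thirds z0 by (simp add: log_def z_def[symmetric] field_simps)
  moreover have "log 2 y \<ge> 0" using y by simp
  ultimately have v: "v \<le> 2 * z" unfolding v_def using z0 by linarith
  have "real k * real l * real v \<le> (4 * X / z) * (lam * t) * (2 * z)"
    using k2 lt v lam t0 X0 z0 by (intro mult_mono) auto
  also have "\<dots> = 8 * (lam * t * X)" using z0 by simp
  finally have "1 + real k * real l * real v \<le> 1 + 8 * (lam * t * X)" by simp
  moreover have "1 * 1 * 1 \<le> lam * t * X" using lam t0 zX z0 by (intro mult_mono) auto
  ultimately have base: "1 + real k * real l * real v \<le> 9 * (lam * t * X)" by simp
  define b where "b = lam * t * X"
  have b1: "b \<ge> 1" using \<open>1 * 1 * 1 \<le> lam * t * X\<close> by (simp add: b_def)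
  \<comment> \<open>Here \<open>36 = 9 * 4\<close>: the 9 comes from the base
    \<open>1 + k * l * v\<close>, and the 4 will absorb the factor \<open>2 ln 2\<close> from the
    power of \<open>ln y\<close>.\<close>
  have "lam * t \<le> w" using lam tu by (simp add: w_def)
  then have "36 * (lam * t) \<le> X" using wz' zX w0 by linarith
  then have "36 * b \<le> X ^ 2" using X0 by (simp add: b_def power2_eq_square)
  then have "ln (36 * b) \<le> ln (X ^ 2)" using b1 X0 by simp
  also have "\<dots> = 2 * u" using X0 by (simp add: ln_realpow u_def)
  finally have lnb: "ln (36 * b) \<le> 2 * u" .
  have kl: "real (k * l) \<le> k * (lam * t)" using lt by (simp add: mult_left_mono)
  have "(1 + real k * real l * real v) ^ (k * l) \<le> (9 * b) ^ (k * l)"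
    using base by (intro power_mono) (auto simp: b_def)
  also have "\<dots> = (9 * b) powr (k * l)" using b1 by (subst powr_realpow) auto
  also have "\<dots> \<le> (9 * b) powr (k * (lam * t))" using kl b1 by (intro powr_mono) auto
  also have "\<dots> = exp (k * (lam * t) * ln (9 * b))" using b1 by (simp add: powr_def)
  finally have 1: "(1 + real k * real l * real v) ^ (k * l) \<le> exp (k * (lam * t) * ln (9 * b))" .
  have "z powr (lam * ln 2 - 1) \<le> z powr (lam * ln 2)" using z0 by (intro powr_mono) auto
  also have "\<dots> = exp (lam * ln 2 * t)" using z0 by (simp add: powr_def t_def)
  finally have "(z powr (lam * ln 2 - 1)) ^ (2 * k) \<le> exp (lam * ln 2 * t) ^ (2 * k)"
    by (intro power_mono) auto
  also have "\<dots> = exp (k * (lam * t) * (2 * ln 2))"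
    by (simp add: exp_of_nat_mult[symmetric] algebra_simps)
  finally have "(1 + real k * real l * real v) ^ (k * l) * (z powr (lam * ln 2 - 1)) ^ (2 * k)
      \<le> exp (k * (lam * t) * ln (9 * b)) * exp (k * (lam * t) * (2 * ln 2))"
    using 1 by (intro mult_mono) auto
  also have "\<dots> = exp (k * (lam * t) * (ln (9 * b) + 2 * ln 2))" by (simp add: exp_add[symmetric] algebra_simps)
  also have "ln (9 * b) + 2 * ln 2 = ln (9 * b) + ln (2 ^ 2)" by (simp only: ln_realpow zero_less_numeral of_nat_numeral)
  also have "\<dots> = ln (36 * b)" using b1 by (subst ln_mult_pos[symmetric]) auto
  also have "exp (k * (lam * t) * ln (36 * b)) \<le> exp (4 * X / z * (lam * t) * (2 * u))"
    unfolding exp_le_cancel_iff using k2 lnb lam t0 b1 X0 z0 by (intro mult_mono) auto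
  also have "4 * X / z * (lam * t) * (2 * u) = X / z * (8 * w * t)" by (simp add: w_def)
  also have "exp \<dots> \<le> exp (X / z * (0.49 * z))"
    unfolding exp_le_cancel_iff t_def using eight_mult_ln_le[OF w0 lnw wz] X0 z0
    by (intro mult_left_mono) auto
  also have "\<dots> = x powr 0.49" using z0 x by (simp add: powr_def X_def)
  finally show "real ((1 + k * l * v) ^ (k * l)) * (ln y powr (lam * ln 2 - 1)) ^ (2 * k) \<le> x powr 0.49"
    by (simp add: z_def)
qed

section \<open>Exceptional moduli for large and for small \<open>x\<close>\<close>

text \<open>For each exceptional \<open>q\<close> one character with a large sum is chosen. Integers
  with many prime factors contribute at most \<open>2 * y / D\<close>, so of the threshold
  \<open>3 * y / D\<close> at least \<open>y / D\<close> is left for the sum over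
  \<open>G\<close>.\<close>

lemma card_exceptional_moduli_le:
  fixes x y lam :: real
  assumes x: "x \<ge> 3" "ln (ln x) \<ge> exp 40" and lam: "lam \<ge> 3" and y: "y \<ge> 3" "y \<le> x"
    and ly: "exp (20 * lam * ln (lam * ln (ln x)) * ln (ln x)) \<le> y"
    and B: "B = {q :: nat. 1 \<le> q \<and> real q \<le> x \<and>
                 \<not> (\<forall>chi. primitive_character q chi \<longrightarrow>
                      cmod (\<Sum>a = 1..nat \<lfloor>y\<rfloor>. chi a) \<le> 3 * y / (ln y) powr (lam * ln 2 - 1))}"
  shows "card B \<le> 3 * x powr 0.49"
proof -
  define D where "D = ln y powr (lam * ln 2 - 1)"
  define k where "k = nat \<lceil>3 * ln x / ln y\<rceil>"
  define l where "l = nat \<lfloor>lam * ln (ln y)\<rfloor>"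
  define v where "v = nat \<lfloor>log 2 y\<rfloor> + 1"
  define Y where "Y = nat \<lfloor>y\<rfloor>"
  have "20 * lam * ln (lam * ln (ln x)) * ln (ln x) \<le> ln y"
    using ly y by (subst ln_ge_iff) auto
  note E = exponent_le[OF _ x(2) lam _ y(2) this, folded k_def l_def v_def D_def]
  have lny: "ln y \<ge> 2" and xk: "x ^ 3 \<le> y ^ k"
    and main: "real ((1 + k * l * v) ^ (k * l)) * D ^ (2 * k) \<le> x powr 0.49"
    using E x y by auto
  have D: "D > 0" using lny by (simp add: D_def)
  have Y: "Y > 0" "real Y \<le> y" using y unfolding Y_def by linarith+
  have finB: "finite B"
    by (rule finite_subset[of _ "{..nat \<lfloor>x\<rfloor>}"]) (auto simp: B le_nat_floor)
  \<comment> \<open>This trivial bound suffices to start: it gives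
    \<open>card B * x\<^sup>2 \<le> x ^ 3 \<le> y ^ k\<close>.\<close>
  have "B \<subseteq> {1..nat \<lfloor>x\<rfloor>}" by (auto simp: B le_nat_floor)
  then have "card B \<le> nat \<lfloor>x\<rfloor>" using card_mono[of "{1..nat \<lfloor>x\<rfloor>}" B] by simp
  then have cB: "card B \<le> x" using x by linarith
  have "\<forall>q\<in>B. \<exists>chi. primitive_character q chi \<and> 3 * y / D < cmod (\<Sum>a = 1..Y. chi a)"
    by (auto simp: B D_def Y_def not_le)
  then obtain chi where chi: "\<And>q. q \<in> B \<Longrightarrow> primitive_character q (chi q)"
      "\<And>q. q \<in> B \<Longrightarrow> 3 * y / D < cmod (\<Sum>a = 1..Y. chi q a)"
    by metis
  define bad where "bad = {a \<in> {1..Y}. card (prime_factors a) > lam * ln (ln y)}"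
  define G where "G = {1..Y} - bad"
  have "card bad * (2 powr (lam * ln (ln y))) \<le> Y * (1 + ln Y)"
    unfolding bad_def using Y(1) by (rule card_many_prime_factors_le)
  also have "\<dots> \<le> y * (2 * ln y)"
  proof (rule mult_mono[OF Y(2)])
    have "ln Y \<le> ln y" using Y by simp
    then show "1 + ln Y \<le> 2 * ln y" using lny by linarith
  qed (use Y y in auto)
  \<comment> \<open>The factor \<open>ln y\<close> lost to the mean of the divisor function is the
    source of the \<open>- 1\<close> in the exponent of \<open>D\<close>.\<close>
  also have "2 powr (lam * ln (ln y)) = D * ln y"
    using lny by (simp add: powr_def D_def exp_diff algebra_simps)
  finally have bad: "card bad \<le> 2 * y / D" using D lny by (simp add: field_simps)
  have V: "y / D \<le> cmod (\<Sum>a\<in>G. chi q a)" if q: "q \<in> B" for q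
  proof -
    have c: "dirichlet_character q (chi q)" using chi(1) q by (simp add: primitive_character_def)
    have "(\<Sum>a\<in>{1..Y}. chi q a) = (\<Sum>a\<in>G. chi q a) + (\<Sum>a\<in>bad. chi q a)"
      unfolding G_def by (intro sum.subset_diff) (auto simp: bad_def)
    moreover have "cmod (\<Sum>a\<in>bad. chi q a) \<le> (\<Sum>a\<in>bad. 1)"
      using dirichlet_character_norm_le_1[OF c] by (intro sum_norm_le) auto
    ultimately have "cmod (\<Sum>a\<in>{1..Y}. chi q a) \<le> cmod (\<Sum>a\<in>G. chi q a) + card bad"
      using norm_triangle_ineq[of "\<Sum>a\<in>G. chi q a" "\<Sum>a\<in>bad. chi q a"] by simp
    then have "3 * y / D < cmod (\<Sum>a\<in>G. chi q a) + 2 * y / D" using chi(2)[OF q] bad by linarith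
    moreover have "3 * y / D = y / D + 2 * y / D" by (simp add: field_simps)
    ultimately show ?thesis by linarith
  qed
  have Y2: "a < 2 ^ v" if "a \<le> Y" for a
  proof -
    have "log 2 y < v" using y unfolding v_def by linarith
    then have "y < 2 ^ v" using y by (simp add: log_less_iff powr_realpow)
    then have "real Y < 2 ^ v" using Y by linarith
    then have "Y < 2 ^ v" by simp
    then show ?thesis using that by linarith
  qed
  have "card B * (y / D) ^ (2 * k) \<le> 3 * real ((1 + k * l * v) ^ (k * l)) * y ^ (2 * k)"
  proof (rule card_large_values_le[OF finB chi(1), where x = x and G = G and y = y])
    show "real q \<le> x" if "q \<in> B" for q using that by (simp add: B)
    show "G \<subseteq> {a. 0 < a \<and> a < 2 ^ v \<and> card (prime_factors a) \<le> l}"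
      using Y2 by (auto simp: G_def bad_def l_def not_less le_nat_floor)
    show "real a \<le> y" if "a \<in> G" for a using that Y by (auto simp: G_def)
    have "card B * x\<^sup>2 \<le> x * x\<^sup>2" using cB by (intro mult_right_mono) auto
    then show "card B * x\<^sup>2 \<le> y ^ k" using xk by (simp add: power2_eq_square power3_eq_cube)
  qed (use D y V in auto)
  then have "card B * (y / D) ^ (2 * k) \<le> (3 * (real ((1 + k * l * v) ^ (k * l)) * D ^ (2 * k))) * (y / D) ^ (2 * k)"
    using D by (simp add: power_divide)
  then have "card B \<le> 3 * (real ((1 + k * l * v) ^ (k * l)) * D ^ (2 * k))"
    using D y by (subst (asm) mult_le_cancel_right_pos) auto
  then show ?thesis using main by linarith
qed

theorem theorem1p2:
  "\<exists>C1 C2 :: real. C1 > 0 \<and> C2 > 0 \<and>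
     (\<forall>x y lam :: real.
        x \<ge> 3 \<and> y \<ge> 3 \<and> 3 \<le> lam \<and> lam \<le> ln y / (ln (ln y))\<^sup>2 \<and>
        exp (20 * lam * ln (lam * ln (ln x)) * ln (ln x)) \<le> y \<and> y \<le> x \<longrightarrow>
        real (card {q :: nat. 1 \<le> q \<and> real q \<le> x \<and>
                 \<not> (\<forall>chi. primitive_character q chi \<longrightarrow>
                      cmod (\<Sum>a = 1..nat \<lfloor>y\<rfloor>. chi a)
                        \<le> C2 * y / (ln y) powr (lam * ln 2 - 1))})
          \<le> C1 * x powr 0.49)"
proof -
  \<comment> \<open>From \<open>x0\<close> on, \<open>ln (ln x) \<ge> exp 40\<close>. Below it, the
    trivial bound \<open>card B \<le> x\<close> is absorbed into the constant.\<close>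
  define x0 :: real where "x0 = exp (exp (exp 40))"
  show ?thesis
  proof (rule exI[of _ "x0 + 3"], rule exI[of _ 3], intro conjI allI impI)
    show "x0 + 3 > 0" unfolding x0_def by (intro add_pos_pos) auto
    fix x y lam :: real
    assume *: "x \<ge> 3 \<and> y \<ge> 3 \<and> 3 \<le> lam \<and> lam \<le> ln y / (ln (ln y))\<^sup>2 \<and>
        exp (20 * lam * ln (lam * ln (ln x)) * ln (ln x)) \<le> y \<and> y \<le> x"
    define B where "B = {q :: nat. 1 \<le> q \<and> real q \<le> x \<and>
                 \<not> (\<forall>chi. primitive_character q chi \<longrightarrow>
                      cmod (\<Sum>a = 1..nat \<lfloor>y\<rfloor>. chi a) \<le> 3 * y / (ln y) powr (lam * ln 2 - 1))}"
    have "card B \<le> (x0 + 3) * x powr 0.49"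
    proof (cases "x \<ge> x0")
      case True
      then have "ln x \<ge> exp (exp 40)" using * unfolding x0_def by (subst ln_ge_iff) auto
      moreover from this have "ln x > 0" using exp_gt_zero[of "exp 40 :: real"] by linarith
      ultimately have "ln (ln x) \<ge> exp 40" by (subst ln_ge_iff) auto
      then have "card B \<le> 3 * x powr 0.49"
        using * by (intro card_exceptional_moduli_le[OF _ _ _ _ _ _ B_def]) auto
      also have "\<dots> \<le> (x0 + 3) * x powr 0.49"
        unfolding x0_def by (intro mult_right_mono) auto
      finally show ?thesis .
    next
      case False
      have "B \<subseteq> {1..nat \<lfloor>x\<rfloor>}" by (auto simp: B_def le_nat_floor)
      then have "card B \<le> nat \<lfloor>x\<rfloor>" using card_mono[of "{1..nat \<lfloor>x\<rfloor>}" B] by simp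
      moreover have "x \<ge> 3" using * by blast
      ultimately have "card B \<le> x" by linarith
      then have "card B \<le> (x0 + 3) * 1" using False by simp
      also have "\<dots> \<le> (x0 + 3) * x powr 0.49"
        using * by (intro mult_left_mono ge_one_powr_ge_zero) (auto simp: x0_def)
      finally show ?thesis .
    qed
    then show "real (card {q :: nat. 1 \<le> q \<and> real q \<le> x \<and>
                 \<not> (\<forall>chi. primitive_character q chi \<longrightarrow>
                      cmod (\<Sum>a = 1..nat \<lfloor>y\<rfloor>. chi a)
                        \<le> 3 * y / (ln y) powr (lam * ln 2 - 1))}) \<le> (x0 + 3) * x powr 0.49"
      by (simp add: B_def)
  qed simp
qed

end
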